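(* Let $(n_j,k_j,d_j)_{j\ge1}$ be a sequence of triples of positive integers with $d_j\ge1$, $k_j\ge 2^{d_j}$, $n_j\ge d_j$, such that $d_j\to\infty$, $n_j-d_j\to\infty$, and $k_j/2^{d_j}\to1$ as $j\to\infty$. Then \[\lim_{j\to\infty}\frac{f(n_j,k_j,d_j)}{\binom{n_j}{d_j}}=c,\qquad\text{where } c=\prod_{i=1}^\infty(1-2^{-i}).\]
   Context: A family $\mathcal{F}$ of subsets of $[n]=\{1,\dots,n\}$ shatters a set $A\subseteq[n]$ if for every $A'\subseteq A$ there is $F\in\mathcal{F}$ with $F\cap A=A'$. For positive integers $n,k,d$, $f(n,k,d)$ denotes the maximum number of $d$-element subsets of $[n]$ that can be shattered by a family $\mathcal{F}\subseteq 2^{[n]}$ with $|\mathcal{F}|\le k$. *)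

theory Defs
  imports "HOL-Analysis.Analysis"
begin

definition shatters :: "'a set set \<Rightarrow> 'a set \<Rightarrow> bool" where
  "shatters F A \<longleftrightarrow> (\<forall>A'. A' \<subseteq> A \<longrightarrow> (\<exists>X\<in>F. X \<inter> A = A'))"

definition shattered_subsets :: "nat \<Rightarrow> nat \<Rightarrow> nat set set \<Rightarrow> nat set set" where
  "shattered_subsets n d F = {A. A \<subseteq> {1..n} \<and> card A = d \<and> shatters F A}"

definition max_shattered :: "nat \<Rightarrow> nat \<Rightarrow> nat \<Rightarrow> nat" where
  "max_shattered n k d =
     Max {card (shattered_subsets n d F) | F. F \<subseteq> Pow {1..n} \<and> card F \<le> k}"

text \<open>The set under \<^const>\<open>Max\<close> is finite and nonempty, so the maximum is a genuine one.\<close>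

lemma max_shattered_candidates:
  "finite {card (shattered_subsets n d F) | F. F \<subseteq> Pow {1..n} \<and> card F \<le> k}"
  "{card (shattered_subsets n d F) | F. F \<subseteq> Pow {1..n} \<and> card F \<le> k} \<noteq> {}"
proof -
  have "finite {F. F \<subseteq> Pow {1..n} \<and> card F \<le> k}"
    by (rule finite_subset[of _ "Pow (Pow {1..n})"]) auto
  then show "finite {card (shattered_subsets n d F) | F. F \<subseteq> Pow {1..n} \<and> card F \<le> k}"
    by simp
  show "{card (shattered_subsets n d F) | F. F \<subseteq> Pow {1..n} \<and> card F \<le> k} \<noteq> {}"
    by (auto intro!: exI[of _ "{}"])
qed

text \<open>
  \<^const>\<open>prodinf\<close> is only meaningful for convergent products, and it indexes from \<open>0\<close>;
  the product over all \<open>i \<ge> 1\<close> is written with the shifted index \<open>Suc i\<close>.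
\<close>

lemma has_prod_one_minus_half_powers:
  "(\<lambda>i. 1 - 1 / 2 ^ Suc i :: real) has_prod (\<Prod>i. 1 - 1 / 2 ^ Suc i)"
proof -
  have "summable (\<lambda>i. (1 / 2 :: real) ^ Suc i)"
    by (subst summable_Suc_iff) (rule summable_geometric, simp)
  then have "summable (\<lambda>i. norm (- (1 / 2 ^ Suc i) :: real))"
    by (simp add: power_divide)
  then have "abs_convergent_prod (\<lambda>i. 1 - 1 / 2 ^ Suc i :: real)"
    unfolding abs_convergent_prod_conv_summable by simp
  then show ?thesis
    by (intro convergent_prod_has_prod abs_convergent_prod_imp_convergent_prod)
qed

end

(*
  Lower bound: attach to every x in [n] a uniformly random vector v_x of F_2^d and take the 2^d sets
  {x. g(v_x) = 1} for g a linear functional. A d-set A is shattered as soon as (v_x), x in A, is a basis,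
  which has probability prod_{i=1}^d (1 - 2^-i).

  Upper bound: fix r and m, and look at disjoint C, T with |T| = m, |C| = d + r - m. If
  k < 2^d + 2^|C|, some slice {X : X Int C = Z}, restricted to T, has at most 2^(m-r) members. If it shatters
  A of size m - r it has exactly that many, and no two of them differ only inside B = T - A.
  The sets B with this last property form a simplicial complex, and by the Hamming (sphere packing)
  bound the link of an i-element face has no clique with 2^(r-i) vertices. Turan-type counting (Caro-Wei and
  convexity, by induction over links) shows that at most a fraction
  prod_{i<r} (2^r - 2^i)/(2^r - 1) + o(1) of the r-sets are faces, as m grows, which is what the binary
  projective geometry attains. This product tends to c as r grows.
*)

theory Submission
  imports Defs "HOL-Library.Z2" "HOL-Library.Function_Algebras"
begin

section \<open>Face counts from clique bounds in links\<close>

text \<open>In terms of \<open>u = 1 / (1 - a z)\<close> this bounds \<open>(1 - 1 / u) ^ t\<close> by its tangent line at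
  \<open>u = 1 / (1 - a)\<close>.\<close>

lemma tangent_inequality:
  fixes a z :: real
  assumes "real t * (1 - a) \<le> 1" "0 \<le> z" "a \<le> 1"
  shows "(z ^ t - 1) * (1 - a * z) \<le> real t * (1 - a) * (z - 1)"
  using assms(1)
proof (induction t)
  case 0
  show ?case by simp
next
  case (Suc t)
  have "real t * (1 - a) \<le> real (Suc t) * (1 - a)"
    using assms(3) by (intro mult_right_mono) auto
  with Suc have IH: "(z ^ t - 1) * (1 - a * z) \<le> real t * (1 - a) * (z - 1)"
    by linarith
  \<comment> \<open>The induction step leaves the remainder
    \<open>(z - 1)\<^sup>2 * (real t * (1 - a) - a)\<close>; the hypothesis for \<open>Suc t\<close>
    says exactly that its second factor is at most 0.\<close>
  have "real t * (1 - a) - a \<le> 0"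
    using Suc.prems by (simp add: algebra_simps)
  then have neg: "(z - 1)\<^sup>2 * (real t * (1 - a) - a) \<le> 0"
    by (simp add: mult_nonneg_nonpos)
  have "(z ^ Suc t - 1) * (1 - a * z)
      = z * ((z ^ t - 1) * (1 - a * z)) + (z - 1) * (1 - a * z)"
    by (simp add: algebra_simps)
  also have "\<dots> \<le> z * (real t * (1 - a) * (z - 1)) + (z - 1) * (1 - a * z)"
    using IH assms(2) by (simp add: mult_left_mono)
  also have "\<dots> = real (Suc t) * (1 - a) * (z - 1) + (z - 1)\<^sup>2 * (real t * (1 - a) - a)"
    by (simp add: algebra_simps power2_eq_square)
  also have "\<dots> \<le> real (Suc t) * (1 - a) * (z - 1)"
    using neg by simp
  finally show ?case .
qed

text \<open>Each summand lies below its tangent, which is affine in \<open>1 / b x\<close>, so only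
  the harmonic sum matters after summation. The bound is the value obtained when every
  \<open>b x\<close> equals \<open>w / N\<close>; \<open>real t \<le> N\<close> is the condition
  under which the tangent stays above.\<close>

lemma sum_power_le_if_harmonic_le:
  fixes b :: "'a \<Rightarrow> real" and N w :: real
  assumes "finite W" "real (card W) = w" "real t \<le> N" "1 \<le> N"
    and b: "\<And>x. x \<in> W \<Longrightarrow> 0 < b x \<and> b x \<le> w"
    and harm: "(\<Sum>x\<in>W. 1 / b x) \<le> N"
  shows "(\<Sum>x\<in>W. (w - b x) ^ t) \<le> w * (w * (1 - 1 / N)) ^ t"
proof (cases "t = 0 \<or> W = {}")
  case True
  then show ?thesis using assms by auto
next
  case False
  then have w: "0 < w" using assms(1,2) by (metis card_gt_0_iff of_nat_0_less_iff)
  show ?thesis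
  \<comment> \<open>For N = 1 the normalisation below would divide by 0. Here every
    \<open>1 / b x\<close> is at least \<open>1 / w\<close> while their sum is at most 1, so all
    \<open>b x\<close> equal w.\<close>
  proof (cases "N = 1")
    case True
    have "t = 1" using True False assms(3) by auto
    have "(\<Sum>x\<in>W. 1 / b x - 1 / w) \<le> 0"
      using harm True assms(2) w by (simp add: sum_subtractf)
    moreover have nn: "1 / b x - 1 / w \<ge> 0" if "x \<in> W" for x
      using b[OF that] w by (simp add: frac_le)
    ultimately have "\<forall>x\<in>W. 1 / b x - 1 / w = 0"
      using assms(1) by (metis (no_types, lifting) order_antisym sum_nonneg sum_nonneg_eq_0_iff)
    then have "\<And>x. x \<in> W \<Longrightarrow> b x = w"
      using b w by (metis eq_iff_diff_eq_0 inverse_eq_divide inverse_eq_iff_eq)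
    then show ?thesis using True \<open>t = 1\<close> by simp
  next
    case N: False
    define a where "a = 1 - 1 / N"
    have a: "0 < a" "a \<le> 1" using N assms(4) by (auto simp: a_def)
    have N1: "1 < N" using N assms(4) by simp
    have point: "(w - b x) ^ t \<le> (w * a) ^ t * (1 + real t / (N * a) * (w / N / b x - 1))"
      if x: "x \<in> W" for x
    proof -
      \<comment> \<open>Scaled so that z = 1, the point of tangency, is the balanced case
        \<open>b x = w / N\<close>.\<close>
      define z where "z = (w - b x) / (w * a)"
      have bx: "0 < b x" "b x \<le> w" using b[OF x] by auto
      have z: "0 \<le> z" using bx w a by (simp add: z_def)
      have t: "real t * (1 - a) \<le> 1" using assms(3) N1 by (simp add: a_def field_simps)
      have az: "1 - a * z = b x / w" using w a by (simp add: z_def field_simps)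
      have "(z ^ t - 1) * (b x / w) \<le> real t * (1 - a) * (z - 1)"
        using tangent_inequality[OF t z a(2)] az by simp
      then have "z ^ t - 1 \<le> real t * (1 - a) * (z - 1) * (w / b x)"
        using bx w by (simp add: field_simps)
      also have "\<dots> = real t / (N * a) * (w / N / b x - 1)"
      proof -
        have N_a: "1 / N = 1 - a" by (simp add: a_def)
        have z1: "z - 1 = (1 / N - b x / w) / a"
          using w a unfolding N_a by (simp add: z_def field_simps)
        have "(1 / N - b x / w) * (w / b x) = w / N / b x - 1"
          using w bx N1 by (simp add: field_simps)
        moreover have "real t * (1 / N) * (q / a) * v = real t / (N * a) * (q * v)" for q v
          by simp
        ultimately show ?thesis unfolding z1 N_a[symmetric] by presburger
      qed
      finally have zt: "z ^ t \<le> 1 + real t / (N * a) * (w / N / b x - 1)" by simp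
      have "w - b x = w * a * z" using w a by (simp add: z_def)
      then have "(w - b x) ^ t = (w * a) ^ t * z ^ t" by (simp add: power_mult_distrib)
      also have "\<dots> \<le> (w * a) ^ t * (1 + real t / (N * a) * (w / N / b x - 1))"
        using zt w a by (intro mult_left_mono) auto
      finally show ?thesis .
    qed
    have "(\<Sum>x\<in>W. (w - b x) ^ t)
        \<le> (\<Sum>x\<in>W. (w * a) ^ t * (1 + real t / (N * a) * (w / N / b x - 1)))"
      by (intro sum_mono point)
    also have "\<dots> = (w * a) ^ t * (w + real t / (N * a) * (w / N * (\<Sum>x\<in>W. 1 / b x) - w))"
    proof -
      have "(\<Sum>x\<in>W. w / N / b x) = w / N * (\<Sum>x\<in>W. 1 / b x)" by (simp add: sum_distrib_left)
      then have "(\<Sum>x\<in>W. P * (1 + K * (w / N / b x - 1)))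
          = P * (w + K * (w / N * (\<Sum>x\<in>W. 1 / b x) - w))" for P K
        by (simp add: sum_distrib_left[symmetric] sum.distrib sum_subtractf assms(2))
      then show ?thesis .
    qed
    also have "\<dots> \<le> (w * a) ^ t * (w + real t / (N * a) * 0)"
    proof -
      have "w / N * (\<Sum>x\<in>W. 1 / b x) \<le> w / N * N"
        using harm w N1 by (intro mult_left_mono) auto
      then have "w / N * (\<Sum>x\<in>W. 1 / b x) - w \<le> 0" using N1 by simp
      then show ?thesis using w a N1
        by (intro mult_left_mono add_left_mono) auto
    qed
    finally show ?thesis by (simp add: a_def mult.commute)
  qed
qed

text \<open>The Caro--Wei bound, applied to the complement graph; the clique is built greedily from vertices
  with the fewest non-neighbours.\<close>

lemma harmonic_le_card_clique:
  fixes E :: "'a \<Rightarrow> 'a \<Rightarrow> bool"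
  assumes "finite W" and irrefl: "\<And>x. \<not> E x x" and sym: "\<And>x y. E x y \<Longrightarrow> E y x"
  shows "\<exists>X \<subseteq> W. (\<forall>x\<in>X. \<forall>y\<in>X. x \<noteq> y \<longrightarrow> E x y) \<and>
    (\<Sum>x\<in>W. 1 / real (card {y\<in>W. \<not> E x y})) \<le> real (card X)"
  using assms(1)
proof (induction "card W" arbitrary: W rule: less_induct)
  case less
  let ?b = "\<lambda>W x. card {y\<in>W. \<not> E x y}"
  show ?case
  proof (cases "W = {}")
    case True
    then show ?thesis by auto
  next
    case False
    define v where "v = arg_min_on (?b W) W"
    have v: "v \<in> W" "\<And>x. x \<in> W \<Longrightarrow> ?b W v \<le> ?b W x"
      using arg_min_if_finite[OF less.prems False, of "?b W"]
      by (auto simp: v_def not_less[symmetric] intro: arg_min_if_finite)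
    define U where "U = {y\<in>W. E v y}"
    define M where "M = {y\<in>W. \<not> E v y}"
    have fin: "finite U" "finite M" using less.prems by (auto simp: U_def M_def)
    have "v \<in> M" using v irrefl by (auto simp: M_def)
    then have M0: "card M > 0" using fin card_gt_0_iff by blast
    have "U \<subset> W" using v irrefl by (auto simp: U_def)
    then have "card U < card W" using less.prems by (simp add: psubset_card_mono)
    from less.hyps[OF this fin(1)] obtain X where X: "X \<subseteq> U"
      "\<forall>x\<in>X. \<forall>y\<in>X. x \<noteq> y \<longrightarrow> E x y" "(\<Sum>x\<in>U. 1 / real (?b U x)) \<le> real (card X)" by blast
    have W: "W = U \<union> M" "U \<inter> M = {}" by (auto simp: U_def M_def)
    have pos: "x \<in> Y \<Longrightarrow> finite Y \<Longrightarrow> ?b Y x > 0" for x Y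
      using irrefl by (subst card_gt_0_iff) auto
    \<comment> \<open>Passing to U costs at most 1: by minimality of v each of the
      \<open>card M\<close> terms over M is at most \<open>1 / card M\<close>, and the terms over U
      only grow when W shrinks to U. This 1 is paid for by adding v to the clique.\<close>
    have "(\<Sum>x\<in>W. 1 / real (?b W x)) = (\<Sum>x\<in>U. 1 / real (?b W x)) + (\<Sum>x\<in>M. 1 / real (?b W x))"
      using W fin sum.union_disjoint[of U M "\<lambda>x. 1 / real (?b W x)"] by simp
    also have "(\<Sum>x\<in>U. 1 / real (?b W x)) \<le> (\<Sum>x\<in>U. 1 / real (?b U x))"
    proof (intro sum_mono)
      fix x assume x: "x \<in> U"
      have "?b U x \<le> ?b W x" using less.prems \<open>U \<subset> W\<close> by (intro card_mono) auto
      then show "1 / real (?b W x) \<le> 1 / real (?b U x)"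
        using pos[OF x fin(1)] by (intro divide_left_mono) auto
    qed
    also have "(\<Sum>x\<in>M. 1 / real (?b W x)) \<le> (\<Sum>x\<in>M. 1 / real (card M))"
    proof (intro sum_mono)
      fix x assume "x \<in> M"
      then have "card M \<le> ?b W x" using v(2)[of x] by (auto simp: M_def)
      then show "1 / real (?b W x) \<le> 1 / real (card M)"
        using M0 by (intro divide_left_mono) auto
    qed
    also have "(\<Sum>x\<in>M. 1 / real (card M)) = 1" using M0 by simp
    finally have le: "(\<Sum>x\<in>W. 1 / real (?b W x)) \<le> real (card X) + 1" using X(3) by linarith
    have "v \<notin> X" using X(1) irrefl by (auto simp: U_def)
    moreover have "finite X" using X(1) fin finite_subset by blast
    ultimately have "real (card (insert v X)) = real (card X) + 1" by simp
    moreover have "insert v X \<subseteq> W" using v X(1) by (auto simp: U_def)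
    moreover have "\<forall>x\<in>insert v X. \<forall>y\<in>insert v X. x \<noteq> y \<longrightarrow> E x y"
      using X(1,2) sym by (auto simp: U_def)
    ultimately show ?thesis using le by (intro exI[of _ "insert v X"]) auto
  qed
qed

text \<open>The probability that \<open>s\<close> independent uniform nonzero vectors of \<open>F\<^sub>2\<^sup>s\<close> form a basis.\<close>

definition binary_basis_density :: "nat \<Rightarrow> real" where
  "binary_basis_density s = (\<Prod>i<s. (2 ^ s - 2 ^ i) / (2 ^ s - 1))"

lemma binary_basis_density_nonneg: "0 \<le> binary_basis_density s"
  unfolding binary_basis_density_def by (intro prod_nonneg divide_nonneg_nonneg) auto

text \<open>The factor with i = 0 equals 1, and each later factor is one for t times a common ratio.
  That ratio is the proportion of nonzero vectors distinct from a given one, which is also the Turan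
  factor for cliques of size \<open>2 ^ Suc t - 1\<close>.\<close>

lemma binary_basis_density_Suc:
  "binary_basis_density (Suc t) = binary_basis_density t * (1 - 1 / (2 ^ Suc t - 1)) ^ t"
proof (cases "t = 0")
  case True
  then show ?thesis by (simp add: binary_basis_density_def)
next
  case False
  have t1: "(2::real) ^ t > 1" using False by simp
  have "binary_basis_density (Suc t)
      = (\<Prod>i<t. (2 ^ Suc t - 2 ^ Suc i) / (2 ^ Suc t - 1))"
    unfolding binary_basis_density_def using t1 by (subst prod.lessThan_Suc_shift) simp
  also have "\<dots> = (\<Prod>i<t. (2 ^ t - 2 ^ i) / (2 ^ t - 1) * (1 - 1 / (2 ^ Suc t - 1)))"
  proof (intro prod.cong refl)
    fix i
    define p q :: real where "p = 2 ^ t" and "q = 2 ^ i"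
    show "((2::real) ^ Suc t - 2 ^ Suc i) / (2 ^ Suc t - 1)
        = (2 ^ t - 2 ^ i) / (2 ^ t - 1) * (1 - 1 / (2 ^ Suc t - 1))"
      using t1 unfolding power_Suc p_def[symmetric] q_def[symmetric]
      by (simp add: divide_simps) (simp add: algebra_simps)
  qed
  also have "\<dots> = binary_basis_density t * (1 - 1 / (2 ^ Suc t - 1)) ^ t"
    by (simp only: binary_basis_density_def prod.distrib prod_constant card_lessThan)
  finally show ?thesis .
qed

text \<open>Faces are counted through their vertices. The link of x lives on the neighbours of x and
  satisfies the same hypotheses with s lowered by one, so induction bounds its faces by a power of
  the degree of x. Caro-Wei and the clique hypothesis at the empty face bound the harmonic sum of
  the non-degrees, and the tangent estimate then bounds the sum of degree powers.\<close>

lemma card_faces_le: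
  fixes \<Delta> :: "'a set set"
  assumes "finite W"
    and down: "\<And>A B. B \<in> \<Delta> \<Longrightarrow> A \<subseteq> B \<Longrightarrow> A \<in> \<Delta>"
    and clique: "\<And>I X. finite I \<Longrightarrow> finite X \<Longrightarrow> I \<in> \<Delta> \<Longrightarrow> I \<inter> X = {} \<Longrightarrow>
      (\<And>x y. x \<in> X \<Longrightarrow> y \<in> X \<Longrightarrow> insert x (insert y I) \<in> \<Delta>) \<Longrightarrow>
      (card X + 1) * 2 ^ card I \<le> (2::nat) ^ s"
  shows "real (card {B \<in> \<Delta>. B \<subseteq> W \<and> card B = s})
    \<le> binary_basis_density s * real (card W) ^ s / fact s"
  using assms
proof (induction s arbitrary: W \<Delta>)
  case 0
  have "{B \<in> \<Delta>. B \<subseteq> W \<and> card B = 0} \<subseteq> {{}}"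
    using finite_subset[OF _ "0.prems"(1)] by (auto simp del: card_0_eq simp: card_eq_0_iff)
  from card_mono[OF _ this] have "card {B \<in> \<Delta>. B \<subseteq> W \<and> card B = 0} \<le> 1"
    by simp
  then show ?case by (simp add: binary_basis_density_def)
next
  case (Suc t)
  note finW = Suc.prems(1) and down = Suc.prems(2) and clique = Suc.prems(3)
  \<comment> \<open>The largest clique size that \<open>clique\<close> permits in the 1-skeleton,
    from \<open>I = {}\<close>. The count \<open>b x\<close> below includes x itself, as E is
    irreflexive, and is therefore positive on W.\<close>
  define N :: real where "N = 2 ^ Suc t - 1"
  define w where "w = real (card W)"
  define E where "E x y \<longleftrightarrow> x \<noteq> y \<and> {x, y} \<in> \<Delta>" for x y
  define nb where "nb x = {y\<in>W. E x y}" for x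
  define b where "b x = card {y\<in>W. \<not> E x y}" for x
  define L where "L x = {I. x \<notin> I \<and> insert x I \<in> \<Delta>}" for x
  let ?S = "{B \<in> \<Delta>. B \<subseteq> W \<and> card B = Suc t}"
  have finS: "finite ?S" by (rule finite_subset[of _ "Pow W"]) (use finW in auto)
  have nb_b: "real (card (nb x)) = w - real (b x)" for x
  proof -
    have "W = nb x \<union> {y\<in>W. \<not> E x y}" "nb x \<inter> {y\<in>W. \<not> E x y} = {}" by (auto simp: nb_def)
    then have "card W = card (nb x) + b x"
      unfolding b_def using finW by (metis (no_types, lifting) card_Un_disjoint finite_Un)
    then show ?thesis by (simp add: w_def)
  qed
  have link: "real (card {B \<in> ?S. x \<in> B})
      \<le> binary_basis_density t * real (card (nb x)) ^ t / fact t" if x: "x \<in> W" for x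
  proof -
    have "{B \<in> ?S. x \<in> B} = insert x ` {B \<in> L x. B \<subseteq> nb x \<and> card B = t}"
    proof (intro equalityI subsetI)
      fix B assume "B \<in> {B \<in> ?S. x \<in> B}"
      then have B: "B \<in> \<Delta>" "B \<subseteq> W" "card B = Suc t" "x \<in> B" by auto
      have "finite B" using B finW finite_subset by blast
      have "{x, y} \<in> \<Delta>" if "y \<in> B" for y using down[OF B(1)] that B(4) by auto
      then have "B - {x} \<subseteq> nb x" using B by (auto simp: nb_def E_def)
      moreover have "insert x (B - {x}) = B" using B by auto
      ultimately show "B \<in> insert x ` {B \<in> L x. B \<subseteq> nb x \<and> card B = t}"
        using B \<open>finite B\<close> by (intro image_eqI[of _ _ "B - {x}"]) (auto simp: L_def)
    next
      fix B assume "B \<in> insert x ` {B \<in> L x. B \<subseteq> nb x \<and> card B = t}"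
      then obtain C where C: "B = insert x C" "C \<in> L x" "C \<subseteq> nb x" "card C = t" by auto
      have "finite C" using C(3) finW finite_subset[of C W] by (auto simp: nb_def)
      then show "B \<in> {B \<in> ?S. x \<in> B}" using C x by (auto simp: L_def nb_def)
    qed
    then have "card {B \<in> ?S. x \<in> B} \<le> card {B \<in> L x. B \<subseteq> nb x \<and> card B = t}"
      using finW by (auto intro!: card_image_le finite_subset[of _ "Pow W"] simp: nb_def)
    moreover have "real (card {B \<in> L x. B \<subseteq> nb x \<and> card B = t})
        \<le> binary_basis_density t * real (card (nb x)) ^ t / fact t"
    proof (rule Suc.IH)
      show "finite (nb x)" using finW by (simp add: nb_def)
      show "A \<in> L x" if "B \<in> L x" "A \<subseteq> B" for A B
        using that down[of "insert x B" "insert x A"] by (auto simp: L_def)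
      fix I X
      assume *: "finite I" "finite X" "I \<in> L x" "I \<inter> X = {}"
        "\<And>u v. u \<in> X \<Longrightarrow> v \<in> X \<Longrightarrow> insert u (insert v I) \<in> L x"
      \<comment> \<open>The hypothesis on pairs includes the diagonal, which gives this. The clique
        condition for I in the link is then the one for \<open>insert x I\<close> in the complex,
        with a factor 2 cancelled.\<close>
      have "x \<notin> X" using *(5) by (auto simp: L_def)
      have "(card X + 1) * 2 ^ card (insert x I) \<le> (2::nat) ^ Suc t"
      proof (rule clique)
        fix u v assume "u \<in> X" "v \<in> X"
        from *(5)[OF this] show "insert u (insert v (insert x I)) \<in> \<Delta>"
          by (simp add: L_def insert_commute)
      qed (use * \<open>x \<notin> X\<close> in \<open>auto simp: L_def\<close>)
      then show "(card X + 1) * 2 ^ card I \<le> (2::nat) ^ t"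
        using * by (simp add: L_def)
    qed
    ultimately show ?thesis by linarith
  qed
  \<comment> \<open>A face in \<open>?S\<close> is needed to know that the empty set is a face, so
    that \<open>clique\<close> applies with \<open>I = {}\<close>.\<close>
  have harm: "(\<Sum>x\<in>W. 1 / real (b x)) \<le> N" if ne: "?S \<noteq> {}"
  proof -
    obtain X where X: "X \<subseteq> W" "\<forall>x\<in>X. \<forall>y\<in>X. x \<noteq> y \<longrightarrow> E x y"
      "(\<Sum>x\<in>W. 1 / real (b x)) \<le> real (card X)"
      using harmonic_le_card_clique[OF finW, of E]
      unfolding b_def E_def by (auto simp: insert_commute)
    have finX: "finite X" using X finW finite_subset by blast
    have "card X + 1 \<le> 2 ^ Suc t"
    \<comment> \<open>E says nothing about single vertices. With at least two vertices in X, each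
      \<open>{x}\<close> is a face because it lies in an edge; a smaller X satisfies the bound
      anyway.\<close>
    proof (cases "card X \<le> 1")
      case True
      have "(2::nat) \<le> 2 ^ Suc t" by simp
      then show ?thesis using True by linarith
    next
      case False
      have "insert x (insert y {}) \<in> \<Delta>" if xy: "x \<in> X" "y \<in> X" for x y
      proof (cases "x = y")
        case True
        obtain z where "z \<in> X" "z \<noteq> x"
          using False finX xy by (metis One_nat_def card_le_Suc0_iff_eq)
        then have "{x, z} \<in> \<Delta>" using X(2) xy by (auto simp: E_def)
        then show ?thesis using down[of "{x, z}" "{x, y}"] True by auto
      qed (use X(2) xy in \<open>auto simp: E_def\<close>)
      moreover have "{} \<in> \<Delta>" using ne down by blast
      ultimately show ?thesis using clique[of "{}" X] finX by simp
    qed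
    then have "real (card X + 1) \<le> real (2 ^ Suc t)" by (simp only: of_nat_le_iff)
    then have "real (card X) \<le> N" by (simp add: N_def)
    then show ?thesis using X(3) by linarith
  qed
  show ?case
  proof (cases "?S = {}")
    case True
    then show ?thesis
      by (simp only: True card.empty) (simp add: binary_basis_density_nonneg)
  next
    case False
    have tN: "real t \<le> N" "1 \<le> N"
    proof -
      have "Suc t \<le> 2 ^ t" "(1::nat) \<le> 2 ^ t"  by (auto simp: Suc_leI)
      then have "real (Suc t) \<le> real (2 ^ t)" "real 1 \<le> real (2 ^ t)" by (simp_all only: of_nat_le_iff)
      then show "real t \<le> N" "1 \<le> N" by (simp_all add: N_def)
    qed
    have "(\<Sum>x\<in>W. (w - real (b x)) ^ t) \<le> w * (w * (1 - 1 / N)) ^ t"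
    proof (rule sum_power_le_if_harmonic_le[OF finW _ tN _ harm[OF False]])
      fix x assume "x \<in> W"
      then have "x \<in> {y\<in>W. \<not> E x y}" by (simp add: E_def)
      then have "b x > 0" unfolding b_def using finW by (subst card_gt_0_iff) auto
      moreover have "b x \<le> card W" unfolding b_def using finW by (intro card_mono) auto
      ultimately show "0 < real (b x) \<and> real (b x) \<le> w" by (simp add: w_def)
    qed (simp add: w_def)
    then have deg: "(\<Sum>x\<in>W. real (card (nb x)) ^ t) \<le> w * (w * (1 - 1 / N)) ^ t"
      by (simp add: nb_b)
    have "(\<Sum>x\<in>W. card {B \<in> ?S. x \<in> B}) = Suc t * card ?S"
    proof (rule sum_multicount[OF finW finS])
      show "\<forall>B\<in>?S. card {x \<in> W. x \<in> B} = Suc t"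
        by (auto simp: Int_def[symmetric] Int_absorb1)
    qed
    then have "real (Suc t) * real (card ?S) = (\<Sum>x\<in>W. real (card {B \<in> ?S. x \<in> B}))"
      by (simp only: of_nat_mult[symmetric] of_nat_sum[symmetric])
    also have "\<dots> \<le> (\<Sum>x\<in>W. binary_basis_density t * real (card (nb x)) ^ t / fact t)"
      by (intro sum_mono link)
    also have "\<dots> = binary_basis_density t / fact t * (\<Sum>x\<in>W. real (card (nb x)) ^ t)"
      by (simp add: sum_distrib_left)
    also have "\<dots> \<le> binary_basis_density t / fact t * (w * (w * (1 - 1 / N)) ^ t)"
      using deg by (intro mult_left_mono) (auto simp: binary_basis_density_nonneg)
    also have "\<dots> = binary_basis_density (Suc t) * w ^ Suc t / fact t"
      by (simp add: binary_basis_density_Suc N_def power_mult_distrib)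
    finally have "real (card ?S) \<le> binary_basis_density (Suc t) * w ^ Suc t / fact t / real (Suc t)"
      by (subst pos_le_divide_eq) (simp_all only: mult.commute of_nat_0_less_iff zero_less_Suc)
    then show ?thesis by (simp add: w_def field_simps)
  qed
qed

section \<open>Shattering and exact codes\<close>

text \<open>Sphere packing: the words \<open>A - I\<close> with at most one coordinate in \<open>X\<close> flipped are pairwise distinct.\<close>

lemma hamming_bound_link:
  fixes F :: "'a set set"
  assumes V: "finite V" "F \<subseteq> Pow V" "card F * 2 ^ s = 2 ^ card V"
    and I: "I \<subseteq> V" "inj_on (\<lambda>A. A - I) F" and X: "finite X" "I \<inter> X = {}"
    and pair: "\<And>x y. x \<in> X \<Longrightarrow> y \<in> X \<Longrightarrow>
      insert x (insert y I) \<subseteq> V \<and> inj_on (\<lambda>A. A - insert x (insert y I)) F"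
  shows "(card X + 1) * 2 ^ card I \<le> (2::nat) ^ s"
proof -
  define Er where "Er = insert {} ((\<lambda>x. {x}) ` X)"
  define \<phi> where "\<phi> = (\<lambda>(A, e). sym_diff (A - I) e)"
  have fin: "finite F" "finite Er" using V X finite_subset[of F "Pow V"] by (auto simp: Er_def)
  have cardEr: "card Er = card X + 1"
    using X by (simp add: Er_def card_image image_iff)
  have XV: "X \<subseteq> V" using pair by blast
  have "inj_on \<phi> (F \<times> Er)"
  proof (rule inj_onI, clarify)
    fix A e B e'
    assume *: "A \<in> F" "e \<in> Er" "B \<in> F" "e' \<in> Er" "\<phi> (A, e) = \<phi> (B, e')"
    then have eq: "sym_diff (A - I) e = sym_diff (B - I) e'" by (simp add: \<phi>_def)
    \<comment> \<open>Two errors touch at most two points of X, so \<open>pair\<close> supplies a J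
      that contains both of them and I. Off J the flipped words agree with A and B, which forces A =
      B and then e = e'.\<close>
    have "\<exists>J. e \<union> e' \<subseteq> J \<and> I \<subseteq> J \<and> inj_on (\<lambda>A. A - J) F"
    proof (cases "e = {} \<and> e' = {}")
      case True
      then show ?thesis using I by auto
    next
      case False
      then obtain x y where "x \<in> X" "y \<in> X" "e \<union> e' \<subseteq> {x, y}"
        using *(2,4) unfolding Er_def by blast
      then show ?thesis using pair[of x y] by (intro exI[of _ "insert x (insert y I)"]) auto
    qed
    then obtain J where J: "e \<union> e' \<subseteq> J" "I \<subseteq> J" "inj_on (\<lambda>A. A - J) F" by blast
    have "A - J = B - J" using eq J(1,2) by blast
    then have "A = B" using J(3) *(1,3) by (auto dest: inj_onD)
    moreover have "e = e'" using eq unfolding \<open>A = B\<close> by blast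
    ultimately show "A = B \<and> e = e'" by simp
  qed
  moreover have "\<phi> ` (F \<times> Er) \<subseteq> Pow (V - I)"
    using V(2) XV X(2) by (auto simp: \<phi>_def Er_def)
  ultimately have "card (F \<times> Er) \<le> card (Pow (V - I))"
    using V(1) by (intro card_inj_on_le) auto
  then have "card F * (card X + 1) \<le> 2 ^ (card V - card I)"
    using V(1) I(1) by (simp add: card_cartesian_product cardEr card_Pow card_Diff_subset finite_subset)
  then have "card F * (card X + 1) * 2 ^ card I \<le> 2 ^ (card V - card I) * 2 ^ card I"
    by (rule mult_right_mono) simp
  also have "\<dots> = 2 ^ card V"
    using card_mono[OF V(1) I(1)] by (simp flip: power_add)
  also have "\<dots> = card F * 2 ^ s" using V(3) by simp
  finally have "card F * ((card X + 1) * 2 ^ card I) \<le> card F * 2 ^ s" by (simp only: mult.assoc)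
  moreover have "card F > 0" using V(3) by (intro gr0I) auto
  ultimately show ?thesis by (simp only: nat_mult_le_cancel_disj)
qed

section \<open>Shattered sets as complements of faces\<close>

lemma shatters_image_eq_Pow:
  assumes "shatters G A"
  shows "(\<lambda>X. X \<inter> A) ` G = Pow A"
proof (intro equalityI subsetI)
  fix A' assume "A' \<in> Pow A"
  then obtain X where "X \<in> G" "X \<inter> A = A'" using assms unfolding shatters_def by blast
  then show "A' \<in> (\<lambda>X. X \<inter> A) ` G" by blast
qed auto

lemma shatters_card_ge:
  assumes "finite G" "finite A" "shatters G A"
  shows "2 ^ card A \<le> card G"
proof -
  have "card (Pow A) \<le> card G"
    using card_image_le[OF assms(1), of "\<lambda>X. X \<inter> A"] by (simp only: shatters_image_eq_Pow[OF assms(3)])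
  then show ?thesis using assms(2) by (simp add: card_Pow)
qed

text \<open>A shattered set A of the given size forces G to have exactly
  \<open>2 ^ (card T - r)\<close> members, told apart by their traces on A. Thus no two of them
  differ only inside \<open>T - A\<close>. The sets with this property form a complex whose clique
  hypothesis is the Hamming bound, and complementation embeds the shattered sets into its
  r-faces.\<close>

lemma card_shattered_exact_le:
  assumes T: "finite T" "G \<subseteq> Pow T" "r \<le> card T" "card G \<le> 2 ^ (card T - r)"
  shows "real (card {A. A \<subseteq> T \<and> card A = card T - r \<and> shatters G A})
    \<le> binary_basis_density r * real (card T) ^ r / fact r"
proof (cases "card G = 2 ^ (card T - r)")
  case False
  have finG: "finite G" using T finite_subset[of G "Pow T"] by auto
  have "{A. A \<subseteq> T \<and> card A = card T - r \<and> shatters G A} = {}"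
  proof (intro equals0I)
    fix A assume "A \<in> {A. A \<subseteq> T \<and> card A = card T - r \<and> shatters G A}"
    then have "finite A" "shatters G A" "card A = card T - r"
      using finite_subset[OF _ T(1)] by auto
    then have "2 ^ (card T - r) \<le> card G" using shatters_card_ge[OF finG] by metis
    then show False using T(4) False by simp
  qed
  then show ?thesis by (simp only: card.empty) (simp add: binary_basis_density_nonneg)
next
  case True
  have finG: "finite G" using T finite_subset[of G "Pow T"] by auto
  define \<Delta> where "\<Delta> = {B. B \<subseteq> T \<and> inj_on (\<lambda>X. X - B) G}"
  let ?S = "{A. A \<subseteq> T \<and> card A = card T - r \<and> shatters G A}"
  have "(\<lambda>A. T - A) ` ?S \<subseteq> {B \<in> \<Delta>. B \<subseteq> T \<and> card B = r}"
  proof (rule image_subsetI)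
    fix A assume "A \<in> ?S"
    then have A: "A \<subseteq> T" "card A = card T - r" "shatters G A" by auto
    have finA: "finite A" by (rule finite_subset[OF A(1) T(1)])
    \<comment> \<open>The exact size of G turns the surjection onto the subsets of A into a
      bijection.\<close>
    have "card ((\<lambda>X. X \<inter> A) ` G) = card G"
      using True A(2) finA by (simp add: shatters_image_eq_Pow[OF A(3)] card_Pow)
    then have inj: "inj_on (\<lambda>X. X \<inter> A) G" using finG by (simp add: eq_card_imp_inj_on)
    have "inj_on (\<lambda>X. X - (T - A)) G"
    proof (rule inj_onI)
      fix X Y assume *: "X \<in> G" "Y \<in> G" "X - (T - A) = Y - (T - A)"
      then have "X \<inter> A = Y \<inter> A" using T(2) by blast
      then show "X = Y" using inj * by (auto dest: inj_onD)
    qed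
    then show "T - A \<in> {B \<in> \<Delta>. B \<subseteq> T \<and> card B = r}"
      using A finA T by (simp add: \<Delta>_def card_Diff_subset)
  qed
  moreover have "inj_on (\<lambda>A. T - A) ?S" by (rule inj_onI) blast
  ultimately have "card ?S \<le> card {B \<in> \<Delta>. B \<subseteq> T \<and> card B = r}"
    using T(1) by (intro card_inj_on_le) auto
  moreover have "real (card {B \<in> \<Delta>. B \<subseteq> T \<and> card B = r})
    \<le> binary_basis_density r * real (card T) ^ r / fact r"
  proof (rule card_faces_le[OF T(1)])
    fix A B assume B: "B \<in> \<Delta>" and AB: "A \<subseteq> B"
    have "inj_on (\<lambda>X. X - A) G"
    proof (rule inj_onI)
      fix X Y assume *: "X \<in> G" "Y \<in> G" "X - A = Y - A"
      have "X - B = Y - B" using *(3) AB by blast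
      then show "X = Y" using B *(1,2) by (auto simp: \<Delta>_def dest: inj_onD)
    qed
    then show "A \<in> \<Delta>" using B AB by (auto simp: \<Delta>_def)
  next
    fix I X
    assume *: "finite I" "finite X" "I \<in> \<Delta>" "I \<inter> X = {}"
      "\<And>x y. x \<in> X \<Longrightarrow> y \<in> X \<Longrightarrow> insert x (insert y I) \<in> \<Delta>"
    show "(card X + 1) * 2 ^ card I \<le> 2 ^ r"
    proof (rule hamming_bound_link[OF T(1,2)])
      show "card G * 2 ^ r = 2 ^ card T" using True T(3) by (simp flip: power_add)
      show "I \<subseteq> T" "inj_on (\<lambda>A. A - I) G" using *(3) by (auto simp: \<Delta>_def)
      show "insert x (insert y I) \<subseteq> T \<and> inj_on (\<lambda>A. A - insert x (insert y I)) G"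
        if "x \<in> X" "y \<in> X" for x y using *(5)[OF that] by (simp add: \<Delta>_def)
    qed (use * in auto)
  qed
  ultimately show ?thesis by linarith
qed

section \<open>Slicing and averaging\<close>

text \<open>Pigeonhole over the \<open>2 ^ card C\<close> possible traces Z on C: some slice has at
  most \<open>2 ^ (card T - r)\<close> members, since otherwise F would be too large. If F shatters
  \<open>C \<union> A\<close>, each single slice already realises every trace on A, so the bound for
  exact codes applies to the small slice.\<close>

lemma card_shattered_slice_le:
  assumes fin: "finite F" "finite C" "finite T" and CT: "C \<inter> T = {}" and r: "r \<le> card T"
    and F: "card F < 2 ^ card C * (2 ^ (card T - r) + 1)"
  shows "real (card {A. A \<subseteq> T \<and> card A = card T - r \<and> shatters F (C \<union> A)})
    \<le> binary_basis_density r * real (card T) ^ r / fact r"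
proof -
  define slice where "slice Z = {X\<in>F. X \<inter> C = Z}" for Z
  have "\<exists>Z\<subseteq>C. card (slice Z) \<le> 2 ^ (card T - r)"
  proof (rule ccontr)
    assume neg: "\<not> ?thesis"
    have *: "2 ^ (card T - r) + 1 \<le> card (slice Z)" if "Z \<in> Pow C" for Z
      using that neg by (auto simp: not_le)
    have "2 ^ card C * (2 ^ (card T - r) + 1 :: nat) = (\<Sum>Z\<in>Pow C. 2 ^ (card T - r) + 1)"
      using fin by (simp add: card_Pow)
    also have "\<dots> \<le> (\<Sum>Z\<in>Pow C. card (slice Z))" by (intro sum_mono *)
    also have "\<dots> = card (\<Union>Z\<in>Pow C. slice Z)"
      using fin by (intro card_UN_disjoint[symmetric]) (auto simp: slice_def)
    also have "\<dots> \<le> card F" using fin by (intro card_mono) (auto simp: slice_def)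
    finally show False using F by simp
  qed
  then obtain Z where Z: "Z \<subseteq> C" "card (slice Z) \<le> 2 ^ (card T - r)" by blast
  define G where "G = (\<lambda>X. X \<inter> T) ` slice Z"
  have G: "G \<subseteq> Pow T" "card G \<le> 2 ^ (card T - r)"
    using Z(2) fin card_image_le[of "slice Z" "\<lambda>X. X \<inter> T"] by (auto simp: G_def slice_def)
  have "shatters G A" if A: "A \<subseteq> T" "shatters F (C \<union> A)" for A
    unfolding shatters_def
  proof (intro allI impI)
    fix A' assume A': "A' \<subseteq> A"
    then have "Z \<union> A' \<subseteq> C \<union> A" using Z by auto
    then obtain X where X: "X \<in> F" "X \<inter> (C \<union> A) = Z \<union> A'"
      using A(2) unfolding shatters_def by meson
    have "X \<inter> C = Z" "X \<inter> T \<inter> A = A'" using X(2) A(1) A' Z(1) CT by blast+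
    then show "\<exists>X\<in>G. X \<inter> A = A'" using X(1) by (auto simp: G_def slice_def)
  qed
  then have "card {A. A \<subseteq> T \<and> card A = card T - r \<and> shatters F (C \<union> A)}
      \<le> card {A. A \<subseteq> T \<and> card A = card T - r \<and> shatters G A}"
    using fin by (intro card_mono) auto
  then show ?thesis
    using card_shattered_exact_le[OF fin(3) G(1) r G(2)] by linarith
qed

text \<open>Double counting of the pairs of (C, T) and D with C \<subseteq> D \<subseteq> C \<union>
  T. Each D lies in equally many such pairs, so the density of S is the average of its local
  densities.\<close>

lemma card_family_le_local_density:
  fixes S :: "'a set set" and \<beta> :: real
  assumes V: "finite V" "c + p + r \<le> card V"
    and S: "\<And>D. D \<in> S \<Longrightarrow> D \<subseteq> V \<and> card D = c + p"
    and loc: "\<And>C T. C \<subseteq> V \<Longrightarrow> T \<subseteq> V \<Longrightarrow> C \<inter> T = {} \<Longrightarrow> card C = c \<Longrightarrow> card T = p + r \<Longrightarrow>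
      real (card {A. A \<subseteq> T \<and> card A = p \<and> C \<union> A \<in> S}) \<le> \<beta>"
  shows "real (card S) * real ((p + r) choose p) \<le> \<beta> * real (card V choose (c + p))"
proof -
  define P where "P = {(C, T). C \<subseteq> V \<and> T \<subseteq> V \<and> C \<inter> T = {} \<and> card C = c \<and> card T = p + r}"
  define R where "R = (\<lambda>(C, T) D :: 'a set. C \<subseteq> D \<and> D \<subseteq> C \<union> T)"
  define M where "M = ((c + p) choose c) * ((card V - (c + p)) choose r)"
  let ?D = "{D. D \<subseteq> V \<and> card D = c + p}"
  have finP: "finite P"
    by (rule finite_subset[of _ "Pow V \<times> Pow V"]) (use V in \<open>auto simp: P_def\<close>)
  have finD: "finite ?D" using V by auto
  have M: "card {q\<in>P. R q D} = M" if D: "D \<in> ?D" for D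
  proof -
    have finDD: "finite D" using D finite_subset[OF _ V(1)] by blast
    \<comment> \<open>For fixed D a pair amounts to a choice of C inside D and of the r points of T
      outside D.\<close>
    have "bij_betw (\<lambda>(C, B). (C, (D - C) \<union> B))
      ({C. C \<subseteq> D \<and> card C = c} \<times> {B. B \<subseteq> V - D \<and> card B = r}) {q\<in>P. R q D}"
    proof (rule bij_betw_byWitness[where f' = "\<lambda>(C, T). (C, T - D)"])
      show "\<forall>q\<in>{C. C \<subseteq> D \<and> card C = c} \<times> {B. B \<subseteq> V - D \<and> card B = r}.
          (case case q of (C, B) \<Rightarrow> (C, (D - C) \<union> B) of (C, T) \<Rightarrow> (C, T - D)) = q" by auto
      show "\<forall>q\<in>{q\<in>P. R q D}. (case case q of (C, T) \<Rightarrow> (C, T - D) of (C, B) \<Rightarrow> (C, (D - C) \<union> B)) = q"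
        by (auto simp: P_def R_def)
      show "(\<lambda>(C, B). (C, (D - C) \<union> B)) `
          ({C. C \<subseteq> D \<and> card C = c} \<times> {B. B \<subseteq> V - D \<and> card B = r}) \<subseteq> {q\<in>P. R q D}"
      proof clarify
        fix C B assume *: "C \<subseteq> D" "c = card C" "B \<subseteq> V - D" "r = card B"
        have fin: "finite C" "finite B"
          using * V finDD by (auto intro: finite_subset[of B V] finite_subset[of C D])
        have "card ((D - C) \<union> B) = card (D - C) + card B"
          using * fin finDD by (intro card_Un_disjoint) auto
        then have "card ((D - C) \<union> B) = p + card B"
          using * D fin by (simp add: card_Diff_subset)
        then show "(C, (D - C) \<union> B) \<in> P \<and> R (C, (D - C) \<union> B) D"
          using * D by (auto simp: P_def R_def)
      qed
      show "(\<lambda>(C, T). (C, T - D)) ` {q\<in>P. R q D}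
        \<subseteq> {C. C \<subseteq> D \<and> card C = c} \<times> {B. B \<subseteq> V - D \<and> card B = r}"
      proof clarify
        fix C T assume *: "(C, T) \<in> P" "R (C, T) D"
        then have CT: "C \<subseteq> V" "T \<subseteq> V" "C \<inter> T = {}" "card C = c" "card T = p + r" "C \<subseteq> D" "D \<subseteq> C \<union> T"
          by (auto simp: P_def R_def)
        have "D - C \<subseteq> T" "T - D = T - (D - C)" using CT by auto
        moreover have "card (D - C) = p"
          using CT D finDD finite_subset[of C D] by (simp add: card_Diff_subset)
        ultimately have "card (T - D) = r"
          using CT finDD by (simp add: card_Diff_subset)
        then show "C \<in> {C. C \<subseteq> D \<and> card C = c} \<and> T - D \<in> {B. B \<subseteq> V - D \<and> card B = r}"
          using CT by auto
      qed
    qed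
    then have "card {q\<in>P. R q D}
        = card ({C. C \<subseteq> D \<and> card C = c} \<times> {B. B \<subseteq> V - D \<and> card B = r})"
      by (simp add: bij_betw_same_card)
    also have "\<dots> = M"
      using D V finDD by (simp add: card_cartesian_product n_subsets M_def card_Diff_subset)
    finally show ?thesis .
  qed
  have fiber: "card {D\<in>Q. R q D} = card {A. A \<subseteq> snd q \<and> card A = p \<and> fst q \<union> A \<in> Q}"
    if q: "q \<in> P" and Q: "Q \<subseteq> ?D" for q Q
  proof -
    obtain C T where CT: "q = (C, T)" "C \<subseteq> V" "T \<subseteq> V" "C \<inter> T = {}" "card C = c" "card T = p + r"
      using q by (auto simp: P_def)
    have finC: "finite C" using CT(2) finite_subset[OF _ V(1)] by blast
    have "bij_betw (\<lambda>D. D - C) {D\<in>Q. R q D} {A. A \<subseteq> T \<and> card A = p \<and> C \<union> A \<in> Q}"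
    proof (rule bij_betw_byWitness[where f' = "\<lambda>A. C \<union> A"])
      show "(\<lambda>D. D - C) ` {D\<in>Q. R q D} \<subseteq> {A. A \<subseteq> T \<and> card A = p \<and> C \<union> A \<in> Q}"
      proof clarify
        fix D assume *: "D \<in> Q" "R q D"
        then have D: "C \<subseteq> D" "D \<subseteq> C \<union> T" "card D = c + p" using CT Q by (auto simp: R_def)
        have "C \<union> (D - C) = D" using D by auto
        then show "D - C \<subseteq> T \<and> card (D - C) = p \<and> C \<union> (D - C) \<in> Q"
          using D * finC CT by (auto simp: card_Diff_subset)
      qed
    qed (use CT in \<open>auto simp: R_def\<close>)
    then show ?thesis using CT(1) by (simp add: bij_betw_same_card)
  qed
  have count: "(\<Sum>q\<in>P. card {A. A \<subseteq> snd q \<and> card A = p \<and> fst q \<union> A \<in> Q}) = M * card Q"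
    if Q: "Q \<subseteq> ?D" for Q
  proof -
    have "(\<Sum>q\<in>P. card {D\<in>Q. R q D}) = M * card Q"
      using Q M finP finD by (intro sum_multicount) (auto intro: finite_subset)
    then show ?thesis using fiber[OF _ Q] by simp
  qed
  have SD: "S \<subseteq> ?D" using S by auto
  have "card {A. A \<subseteq> snd q \<and> card A = p \<and> fst q \<union> A \<in> ?D} = (p + r) choose p"
    if q: "q \<in> P" for q
  proof -
    obtain C T where CT: "q = (C, T)" "C \<subseteq> V" "T \<subseteq> V" "C \<inter> T = {}" "card C = c" "card T = p + r"
      using q by (auto simp: P_def)
    have fin: "finite C" "finite T" using CT(2,3) finite_subset[OF _ V(1)] by blast+
    have "card (C \<union> A) = c + p" if "A \<subseteq> T" "card A = p" for A
      using that CT fin by (subst card_Un_disjoint) (auto intro: finite_subset)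
    then have "{A. A \<subseteq> snd q \<and> card A = p \<and> fst q \<union> A \<in> ?D} = {A. A \<subseteq> T \<and> card A = p}"
      using CT by auto
    then show ?thesis using fin CT by (simp add: n_subsets)
  qed
  \<comment> \<open>The same count for the full layer of (c + p)-sets evaluates
    \<open>card P\<close>, and M then cancels; it is positive because
    \<open>c + p + r \<le> card V\<close>.\<close>
  then have all: "card P * ((p + r) choose p) = M * (card V choose (c + p))"
    using count[of ?D] V by (simp add: n_subsets)
  have "real M * real (card S) = (\<Sum>q\<in>P. real (card {A. A \<subseteq> snd q \<and> card A = p \<and> fst q \<union> A \<in> S}))"
    using count[OF SD] by (simp only: of_nat_mult[symmetric] of_nat_sum[symmetric])
  also have "\<dots> \<le> (\<Sum>q\<in>P. \<beta>)" by (intro sum_mono loc) (auto simp: P_def)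
  finally have "real M * real (card S) * real ((p + r) choose p)
      \<le> real (card P) * \<beta> * real ((p + r) choose p)"
    by (intro mult_right_mono) auto
  also have "\<dots> = \<beta> * real (card P * ((p + r) choose p))" by simp
  also have "\<dots> = real M * (\<beta> * real (card V choose (c + p)))" unfolding all by simp
  finally have "real M * (real (card S) * real ((p + r) choose p))
      \<le> real M * (\<beta> * real (card V choose (c + p)))" by (simp add: mult.assoc)
  moreover have "M > 0" using V by (simp add: M_def)
  ultimately show ?thesis by (simp add: mult_le_cancel_left_pos)
qed

section \<open>Random linear codes\<close>

definition bit_scale :: "bit \<Rightarrow> (nat \<Rightarrow> bit) \<Rightarrow> nat \<Rightarrow> bit" where
  "bit_scale c v = (\<lambda>i. c * v i)"

interpretation bits: vector_space bit_scale
  by unfold_locales (auto simp: bit_scale_def fun_eq_iff algebra_simps)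

interpretation bits_functional: vector_space_pair bit_scale "(*) :: bit \<Rightarrow> bit \<Rightarrow> bit"
  by unfold_locales (auto simp: algebra_simps)

text \<open>A copy of F_2^d inside the space of all bit sequences, so that one type serves every
  dimension.\<close>

definition bit_vectors :: "nat \<Rightarrow> (nat \<Rightarrow> bit) set" where
  "bit_vectors d = {v. \<forall>i\<ge>d. v i = 0}"

lemma card_bit_vectors: "finite (bit_vectors d)" "card (bit_vectors d) = 2 ^ d"
proof -
  have "bij_betw (\<lambda>v. {i. v i = 1}) (bit_vectors d) (Pow {..<d})"
  proof (rule bij_betw_byWitness[where f' = "\<lambda>S i. of_bool (i \<in> S)"])
    have "of_bool (v i = 1) = v i" for v :: "nat \<Rightarrow> bit" and i by (cases "v i") simp_all
    then show "\<forall>v\<in>bit_vectors d. (\<lambda>i. of_bool (i \<in> {i. v i = 1})) = v" by simp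
    show "\<forall>S\<in>Pow {..<d}. {i. of_bool (i \<in> S) = (1 :: bit)} = S" by simp
    show "(\<lambda>v. {i. v i = 1}) ` bit_vectors d \<subseteq> Pow {..<d}"
    proof (intro image_subsetI PowI subsetI)
      fix v i assume "v \<in> bit_vectors d" "i \<in> {i. v i = 1}"
      then show "i \<in> {..<d}" by (cases "d \<le> i") (auto simp: bit_vectors_def)
    qed
    show "(\<lambda>S i. of_bool (i \<in> S)) ` Pow {..<d} \<subseteq> bit_vectors d"
      by (auto simp: bit_vectors_def)
  qed
  then show "finite (bit_vectors d)" "card (bit_vectors d) = 2 ^ d"
    by (simp_all add: bij_betw_finite bij_betw_same_card card_Pow)
qed

lemma card_bits_span_le:
  assumes "finite S"
  shows "finite (bits.span S) \<and> card (bits.span S) \<le> 2 ^ card S"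
  using assms
proof (induction S)
  case empty
  show ?case by (simp add: bits.span_empty)
next
  case (insert a S)
  \<comment> \<open>The only multiples of a are 0 and a, so adjoining a adds at most one translate
    of the span.\<close>
  let ?U = "bits.span S \<union> (\<lambda>y. y + a) ` bits.span S"
  have sub: "bits.span (insert a S) \<subseteq> ?U"
  proof
    fix x assume "x \<in> bits.span (insert a S)"
    then obtain c where c: "x - bit_scale c a \<in> bits.span S"
      unfolding bits.span_insert by blast
    consider "c = 0" | "c = 1" by (cases c) auto
    then show "x \<in> ?U"
    proof cases
      case 1
      then have "x - bit_scale c a = x" by (simp add: bit_scale_def fun_eq_iff)
      with c show ?thesis by (metis UnI1)
    next
      case 2
      then have "bit_scale c a = a" by (simp only: bit_scale_def mult_1_left)
      then have "x - a \<in> bits.span S" "x = (x - a) + a" using c by simp_all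
      then show ?thesis by blast
    qed
  qed
  have fin: "finite ?U" using insert.IH by simp
  have "card (bits.span (insert a S)) \<le> card ?U" by (rule card_mono[OF fin sub])
  also have "\<dots> \<le> card (bits.span S) + card (bits.span S)"
    using card_Un_le[of "bits.span S" "(\<lambda>y. y + a) ` bits.span S"]
      card_image_le[of "bits.span S" "\<lambda>y. y + a"] insert.IH by linarith
  also have "\<dots> \<le> 2 ^ card (insert a S)" using insert by simp
  finally show ?case using finite_subset[OF sub fin] by blast
qed

text \<open>Independence of an indexed family: injectivity excludes repeated vectors, which the
  image set would hide.\<close>

definition bits_indep_on :: "('a \<Rightarrow> nat \<Rightarrow> bit) \<Rightarrow> 'a set \<Rightarrow> bool" where
  "bits_indep_on v A \<longleftrightarrow> inj_on v A \<and> bits.independent (v ` A)"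

text \<open>Splits off one coordinate, so that independence can be counted one vector at a
  time.\<close>

lemma card_PiE_insert_Collect:
  assumes "finite I" "finite V" "x \<notin> I"
  shows "card {v \<in> insert x I \<rightarrow>\<^sub>E V. Q v} = (\<Sum>g\<in>I \<rightarrow>\<^sub>E V. card {y\<in>V. Q (g(x := y))})"
proof -
  have "{v \<in> insert x I \<rightarrow>\<^sub>E V. Q v}
      = (\<lambda>(g, y). g(x := y)) ` (SIGMA g:I \<rightarrow>\<^sub>E V. {y\<in>V. Q (g(x := y))})"
    unfolding PiE_insert_eq by force
  moreover have "inj_on (\<lambda>(g, y). g(x := y)) (SIGMA g:I \<rightarrow>\<^sub>E V. {y\<in>V. Q (g(x := y))})"
  proof (rule inj_onI, clarify)
    fix g y g' y'
    assume *: "g \<in> I \<rightarrow>\<^sub>E V" "g' \<in> I \<rightarrow>\<^sub>E V" "g(x := y) = g'(x := y')"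
    have "g i = g' i" for i
      using *(1,2) fun_cong[OF *(3), of i] assms(3) by (cases "i = x") (auto simp: PiE_def extensional_def)
    moreover have "y = y'" using fun_cong[OF *(3), of x] by simp
    ultimately show "g = g' \<and> y = y'" by auto
  qed
  ultimately show ?thesis
    using assms by (simp add: card_image finite_PiE)
qed

text \<open>Coordinates are added one by one. One outside A is free; one in A has only to avoid the
  span of the vectors already placed on A, which has at most \<open>2 ^ card B\<close> elements. For
  \<open>card A > d\<close> the factor with i = d is 0 and the bound is trivial.\<close>

lemma card_bits_indep_on_ge:
  assumes "finite I" "A \<subseteq> I"
  shows "(\<Prod>i<card A. 2 ^ d - 2 ^ i) * (2 ^ d) ^ (card I - card A)
    \<le> card {v \<in> I \<rightarrow>\<^sub>E bit_vectors d. bits_indep_on v A}"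
  using assms
proof (induction I arbitrary: A)
  case empty
  then have "{v \<in> {} \<rightarrow>\<^sub>E bit_vectors d. bits_indep_on v A} = {\<lambda>_. undefined}"
    by (auto simp: bits_indep_on_def bits.independent_empty)
  then show ?case using empty by simp
next
  case (insert x I)
  note finV = card_bit_vectors
  have finPi: "finite (I \<rightarrow>\<^sub>E bit_vectors d)" using insert.hyps finV by (simp add: finite_PiE)
  show ?case
  proof (cases "x \<in> A")
    case False
    then have A: "A \<subseteq> I" using insert.prems by auto
    have indep: "bits_indep_on (g(x := y)) A \<longleftrightarrow> bits_indep_on g A" for g y
    proof -
      have "(g(x := y)) ` A = g ` A" "inj_on (g(x := y)) A \<longleftrightarrow> inj_on g A"
        using False by (auto intro!: inj_on_cong cong: image_cong)
      then show ?thesis by (simp add: bits_indep_on_def)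
    qed
    have "card A \<le> card I" using A insert.hyps by (simp add: card_mono)
    then have "(\<Prod>i<card A. 2 ^ d - 2 ^ i) * (2 ^ d) ^ (card (insert x I) - card A)
        = (\<Prod>i<card A. 2 ^ d - 2 ^ i) * (2 ^ d) ^ (card I - card A) * (2::nat) ^ d"
      using insert.hyps by (simp add: Suc_diff_le)
    also have "\<dots> \<le> card {g \<in> I \<rightarrow>\<^sub>E bit_vectors d. bits_indep_on g A} * 2 ^ d"
      by (intro mult_right_mono insert.IH A) simp
    also have "\<dots> = (\<Sum>g\<in>{g \<in> I \<rightarrow>\<^sub>E bit_vectors d. bits_indep_on g A}. card (bit_vectors d))"
      by (simp add: finV)
    also have "\<dots> = (\<Sum>g\<in>{g \<in> I \<rightarrow>\<^sub>E bit_vectors d. bits_indep_on g A}.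
        card {y \<in> bit_vectors d. bits_indep_on (g(x := y)) A})"
      by (intro sum.cong) (auto simp: indep)
    also have "\<dots> \<le> (\<Sum>g\<in>I \<rightarrow>\<^sub>E bit_vectors d. card {y \<in> bit_vectors d. bits_indep_on (g(x := y)) A})"
      using finPi by (intro sum_mono2) auto
    also have "\<dots> = card {v \<in> insert x I \<rightarrow>\<^sub>E bit_vectors d. bits_indep_on v A}"
      using insert.hyps finV by (simp add: card_PiE_insert_Collect)
    finally show ?thesis .
  next
    case True
    define B where "B = A - {x}"
    have B: "B \<subseteq> I" "A = insert x B" "x \<notin> B" "finite B"
      using True insert.prems insert.hyps finite_subset[of A "insert x I"] by (auto simp: B_def)
    have ext: "2 ^ d - 2 ^ card B \<le> card {y \<in> bit_vectors d. bits_indep_on (g(x := y)) A}"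
      if g: "bits_indep_on g B" for g
    proof -
      have cs: "finite (bits.span (g ` B))" "card (bits.span (g ` B)) \<le> 2 ^ card B"
        using card_bits_span_le[of "g ` B"] B g
        by (auto simp: bits_indep_on_def card_image)
      have "2 ^ d - 2 ^ card B \<le> card (bit_vectors d) - card (bits.span (g ` B))"
        using cs by (simp add: finV)
      also have "\<dots> \<le> card (bit_vectors d - bits.span (g ` B))"
        using cs by (intro diff_card_le_card_Diff) auto
      also have "\<dots> \<le> card {y \<in> bit_vectors d. bits_indep_on (g(x := y)) A}"
      proof (intro card_mono subsetI)
        fix y assume y: "y \<in> bit_vectors d - bits.span (g ` B)"
        have notin: "y \<notin> g ` B" using y bits.span_base[of y "g ` B"] by blast
        have im: "(g(x := y)) ` A = insert y (g ` B)" using B(2,3) by auto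
        have "inj_on (g(x := y)) A"
          using g notin B(3) unfolding B(2) bits_indep_on_def
          by (auto simp: inj_on_def)
        moreover have "bits.independent (insert y (g ` B))"
          using g y by (intro bits.independent_insertI) (auto simp: bits_indep_on_def)
        ultimately have "bits_indep_on (g(x := y)) A"
          unfolding bits_indep_on_def im by blast
        then show "y \<in> {y \<in> bit_vectors d. bits_indep_on (g(x := y)) A}" using y by auto
      qed (simp add: finV)
      finally show ?thesis .
    qed
    have "(\<Prod>i<card A. 2 ^ d - 2 ^ i) * (2 ^ d) ^ (card (insert x I) - card A)
        = (\<Prod>i<card B. 2 ^ d - 2 ^ i) * (2 ^ d) ^ (card I - card B) * ((2::nat) ^ d - 2 ^ card B)"
      using insert.hyps B by simp
    also have "\<dots> \<le> card {g \<in> I \<rightarrow>\<^sub>E bit_vectors d. bits_indep_on g B} * (2 ^ d - 2 ^ card B)"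
      by (intro mult_right_mono insert.IH B) simp
    also have "\<dots> = (\<Sum>g\<in>{g \<in> I \<rightarrow>\<^sub>E bit_vectors d. bits_indep_on g B}. 2 ^ d - 2 ^ card B)"
      by simp
    also have "\<dots> \<le> (\<Sum>g\<in>{g \<in> I \<rightarrow>\<^sub>E bit_vectors d. bits_indep_on g B}.
        card {y \<in> bit_vectors d. bits_indep_on (g(x := y)) A})"
      by (intro sum_mono ext) auto
    also have "\<dots> \<le> (\<Sum>g\<in>I \<rightarrow>\<^sub>E bit_vectors d. card {y \<in> bit_vectors d. bits_indep_on (g(x := y)) A})"
      using finPi by (intro sum_mono2) auto
    also have "\<dots> = card {v \<in> insert x I \<rightarrow>\<^sub>E bit_vectors d. bits_indep_on v A}"
      using insert.hyps finV by (simp add: card_PiE_insert_Collect)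
    finally show ?thesis .
  qed
qed

section \<open>Shattering by linear codes\<close>

text \<open>A coordinate set S stands for the functional that sums the coordinates in S; every
  functional on F_2^d has this form.\<close>

definition linear_code :: "'a set \<Rightarrow> nat \<Rightarrow> ('a \<Rightarrow> nat \<Rightarrow> bit) \<Rightarrow> 'a set set" where
  "linear_code I d v = (\<lambda>S. {x\<in>I. (\<Sum>i\<in>S. v x i) = 1}) ` Pow {..<d}"

lemma card_linear_code_le: "card (linear_code I d v) \<le> 2 ^ d"
  using card_image_le[of "Pow {..<d}"] by (simp add: linear_code_def card_Pow)

lemma bit_vector_eq_sum_unit:
  assumes "v \<in> bit_vectors d"
  shows "v = (\<Sum>i<d. bit_scale (v i) (\<lambda>j. of_bool (j = i)))"
proof
  fix j
  have app: "(\<Sum>i\<in>K. f i) j = (\<Sum>i\<in>K. f i j)" for K and f :: "nat \<Rightarrow> nat \<Rightarrow> bit"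
    by (induction K rule: infinite_finite_induct) auto
  show "v j = (\<Sum>i<d. bit_scale (v i) (\<lambda>j. of_bool (j = i))) j"
  proof -
    have "(\<Sum>i<d. v i * of_bool (j = i)) = (\<Sum>i<d. if i = j then v j else 0)"
      by (intro sum.cong) auto
    then show ?thesis
      unfolding app bit_scale_def using assms by (simp add: bit_vectors_def)
  qed
qed

text \<open>A functional may be prescribed freely on independent vectors, so the indicator of any A'
  \<subseteq> A is the trace of a codeword.\<close>

lemma shatters_linear_code:
  assumes "A \<subseteq> I" "v ` A \<subseteq> bit_vectors d" "bits_indep_on v A"
  shows "shatters (linear_code I d v) A"
  unfolding shatters_def
proof (intro allI impI)
  fix A' assume A': "A' \<subseteq> A"
  have inj: "inj_on v A" and ind: "bits.independent (v ` A)"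
    using assms(3) by (auto simp: bits_indep_on_def)
  obtain g where lin: "Vector_Spaces.linear bit_scale ((*) :: bit \<Rightarrow> _) g"
    and g: "\<forall>w\<in>v ` A. g w = of_bool (w \<in> v ` A')"
    using bits_functional.linear_independent_extend[OF ind, of "\<lambda>w. of_bool (w \<in> v ` A')"] by blast
  interpret g: Vector_Spaces.linear bit_scale "(*) :: bit \<Rightarrow> bit \<Rightarrow> bit" g by fact
  \<comment> \<open>The unit vectors on which g is 1; on \<open>bit_vectors d\<close> the functional
    g is the sum of these coordinates.\<close>
  define S where "S = {i. i < d \<and> g (\<lambda>j. of_bool (j = i)) = 1}"
  have val: "(\<Sum>i\<in>S. v x i) = of_bool (x \<in> A')" if x: "x \<in> A" for x
  proof -
    have "g (v x) = g (\<Sum>i<d. bit_scale (v x i) (\<lambda>j. of_bool (j = i)))"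
      using bit_vector_eq_sum_unit[of "v x" d] assms(2) x by auto
    also have "\<dots> = (\<Sum>i<d. v x i * g (\<lambda>j. of_bool (j = i)))"
      by (simp add: g.sum g.scale)
    also have "\<dots> = (\<Sum>i<d. if g (\<lambda>j. of_bool (j = i)) = 1 then v x i else 0)"
      by (intro sum.cong) auto
    also have "\<dots> = (\<Sum>i\<in>S. v x i)"
      by (simp add: S_def sum.If_cases Int_def lessThan_def)
    finally have "(\<Sum>i\<in>S. v x i) = g (v x)" ..
    \<comment> \<open>g is prescribed on vectors, so injectivity of v is needed to return to
      indices.\<close>
    moreover have "v x \<in> v ` A' \<longleftrightarrow> x \<in> A'"
      using inj_on_image_mem_iff[OF inj x A'] .
    ultimately show ?thesis using g x by simp
  qed
  have "{x\<in>I. (\<Sum>i\<in>S. v x i) = 1} \<in> linear_code I d v"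
    by (auto simp: linear_code_def S_def)
  moreover have "{x\<in>I. (\<Sum>i\<in>S. v x i) = 1} \<inter> A = A'"
    using val assms(1) A' by auto
  ultimately show "\<exists>X\<in>linear_code I d v. X \<inter> A = A'" by blast
qed

section \<open>The lower bound by averaging over random codes\<close>

lemma prod_one_minus_half_powers_rev:
  "(\<Prod>i<d. 1 - 1 / 2 ^ (d - i)) = (\<Prod>i<d. 1 - 1 / 2 ^ Suc i :: real)"
proof -
  have "(\<Prod>i<d. 1 - 1 / 2 ^ (d - i) :: real) = (\<Prod>i<d. 1 - 1 / 2 ^ Suc (d - Suc i))"
    by (intro prod.cong) (auto simp del: power_Suc simp: Suc_diff_Suc)
  then show ?thesis
    using prod.nat_diff_reindex[of "\<lambda>i. 1 - 1 / 2 ^ Suc i :: real" d] by (simp only:)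
qed

lemma max_shattered_ge:
  assumes "F \<subseteq> Pow {1..n}" "card F \<le> k"
  shows "card (shattered_subsets n d F) \<le> max_shattered n k d"
  unfolding max_shattered_def using assms
  by (intro Max_ge max_shattered_candidates) auto

text \<open>First moment method: count the pairs of an assignment v and a d-set on which v is
  independent. For fixed v all these d-sets are shattered by one code with at most
  \<open>2 ^ d\<close> members, so their number is at most the maximum.\<close>

lemma max_shattered_lower_bound:
  assumes "2 ^ d \<le> k" "d \<le> n"
  shows "real (n choose d) * (\<Prod>i<d. 1 - 1 / 2 ^ Suc i) \<le> real (max_shattered n k d)"
proof -
  define \<Omega> where "\<Omega> = {1..n} \<rightarrow>\<^sub>E bit_vectors d"
  let ?D = "{A. A \<subseteq> {1..n} \<and> card A = d}"
  have fin: "finite \<Omega>" "finite ?D" "card \<Omega> = (2 ^ d) ^ n"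
    by (simp_all add: \<Omega>_def card_bit_vectors finite_PiE card_funcsetE)
  have cardD: "card ?D = n choose d" using n_subsets[of "{1..n}" d] by simp
  have "(\<Prod>i<d. 2 ^ d - 2 ^ i) * (2 ^ d) ^ (n - d) * (n choose d)
      = (\<Sum>A\<in>?D. (\<Prod>i<card A. 2 ^ d - 2 ^ i) * (2 ^ d) ^ (card {1..n} - card A))"
    by (simp add: cardD[simplified])
  also have "\<dots> \<le> (\<Sum>A\<in>?D. card {v\<in>\<Omega>. bits_indep_on v A})"
    unfolding \<Omega>_def by (intro sum_mono card_bits_indep_on_ge) auto
  also have "\<dots> = (\<Sum>v\<in>\<Omega>. card {A\<in>?D. bits_indep_on v A})"
    using fin by (intro sum_multicount_gen[symmetric]) auto
  also have "\<dots> \<le> (\<Sum>v\<in>\<Omega>. max_shattered n k d)"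
  proof (intro sum_mono)
    fix v assume v: "v \<in> \<Omega>"
    have "{A\<in>?D. bits_indep_on v A} \<subseteq> shattered_subsets n d (linear_code {1..n} d v)"
      using v by (auto simp: shattered_subsets_def \<Omega>_def intro!: shatters_linear_code)
    then have "card {A\<in>?D. bits_indep_on v A} \<le> card (shattered_subsets n d (linear_code {1..n} d v))"
      by (intro card_mono) (auto simp: shattered_subsets_def)
    also have "\<dots> \<le> max_shattered n k d"
      using card_linear_code_le[of "{1..n}" d v] assms(1)
      by (intro max_shattered_ge) (auto simp: linear_code_def)
    finally show "card {A\<in>?D. bits_indep_on v A} \<le> max_shattered n k d" .
  qed
  also have "\<dots> = (2 ^ d) ^ n * max_shattered n k d" by (simp add: fin)
  finally have "real ((\<Prod>i<d. 2 ^ d - 2 ^ i) * (2 ^ d) ^ (n - d) * (n choose d))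
      \<le> real ((2 ^ d) ^ n * max_shattered n k d)"
    by (simp only: of_nat_le_iff)
  \<comment> \<open>Taking \<open>2 ^ d\<close> out of every factor leaves the partial product of c
    in reverse order.\<close>
  moreover have "real (\<Prod>i<d. 2 ^ d - 2 ^ i) = (2 ^ d) ^ d * (\<Prod>i<d. 1 - 1 / 2 ^ Suc i)"
  proof -
    have "real (\<Prod>i<d. 2 ^ d - 2 ^ i) = (\<Prod>i<d. 2 ^ d * (1 - 1 / 2 ^ (d - i)))"
      unfolding of_nat_prod
    proof (intro prod.cong refl)
      fix i assume i: "i \<in> {..<d}"
      then have "(2::real) ^ d = 2 ^ (d - i) * 2 ^ i" by (simp flip: power_add)
      then have "2 ^ d * (1 - 1 / 2 ^ (d - i)) = (2 ^ d - 2 ^ i :: real)"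
        by (simp add: right_diff_distrib)
      moreover have "real (2 ^ d - 2 ^ i) = 2 ^ d - 2 ^ i"
        using i by (simp add: of_nat_diff)
      ultimately show "real (2 ^ d - 2 ^ i) = 2 ^ d * (1 - 1 / 2 ^ (d - i))"
        by simp
    qed
    also have "\<dots> = (2 ^ d) ^ d * (\<Prod>i<d. 1 - 1 / 2 ^ (d - i))"
      by (simp only: prod.distrib prod_constant card_lessThan)
    finally show ?thesis by (simp only: prod_one_minus_half_powers_rev)
  qed
  moreover have "((2::real) ^ d) ^ n = (2 ^ d) ^ d * (2 ^ d) ^ (n - d)"
    using assms(2) by (simp flip: power_add)
  ultimately have "((2 ^ d) ^ d * (2 ^ d) ^ (n - d)) * (real (n choose d) * (\<Prod>i<d. 1 - 1 / 2 ^ Suc i))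
      \<le> ((2 ^ d) ^ d * (2 ^ d) ^ (n - d)) * real (max_shattered n k d)"
    by (simp add: mult_ac)
  then show ?thesis by (subst (asm) mult_le_cancel_left_pos) auto
qed

section \<open>The limit\<close>

text \<open>Here m is the size of T. With c = d + r - m and p = m - r one has c + p = d, so the
  bound on k reads \<open>k < 2 ^ c * (2 ^ p + 1)\<close>, as slicing requires, and
  \<open>d + r \<le> n\<close> leaves room for disjoint C and T.\<close>

lemma max_shattered_upper_bound:
  assumes "r \<le> m" "m \<le> d + r" "d + r \<le> n" "k < 2 ^ d + 2 ^ (d + r - m)"
  shows "real (max_shattered n k d) * real (m choose r)
    \<le> binary_basis_density r * real m ^ r / fact r * real (n choose d)"
proof -
  have "max_shattered n k d \<in> {card (shattered_subsets n d F) | F. F \<subseteq> Pow {1..n} \<and> card F \<le> k}"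
    unfolding max_shattered_def by (intro Max_in max_shattered_candidates)
  then obtain F where F: "F \<subseteq> Pow {1..n}" "card F \<le> k"
    and max: "max_shattered n k d = card (shattered_subsets n d F)" by auto
  define c p where "c = d + r - m" and "p = m - r"
  have cp: "c + p = d" "p + r = m" using assms by (auto simp: c_def p_def)
  have finF: "finite F" using finite_subset[OF F(1)] by simp
  have "real (card (shattered_subsets n d F)) * real ((p + r) choose p)
      \<le> binary_basis_density r * real m ^ r / fact r * real (card {1..n} choose (c + p))"
  proof (rule card_family_le_local_density)
    show "c + p + r \<le> card {1..n}" using cp assms by simp
    show "D \<subseteq> {1..n} \<and> card D = c + p" if "D \<in> shattered_subsets n d F" for D
      using that cp by (simp add: shattered_subsets_def)
  next
    fix C T
    assume *: "C \<subseteq> {1..n}" "T \<subseteq> {1..n}" "C \<inter> T = {}" "card C = c" "card T = p + r"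
    have fin: "finite C" "finite T" using * finite_subset[OF _ finite_atLeastAtMost] by blast+
    have "card F < 2 ^ c * (2 ^ p + 1)"
      using F(2) assms(4) cp(1) by (auto simp: c_def[symmetric] distrib_left simp flip: power_add)
    then have "real (card {A. A \<subseteq> T \<and> card A = card T - r \<and> shatters F (C \<union> A)})
        \<le> binary_basis_density r * real (card T) ^ r / fact r"
      using * fin finF by (intro card_shattered_slice_le) auto
    moreover have "{A. A \<subseteq> T \<and> card A = p \<and> C \<union> A \<in> shattered_subsets n d F}
        \<subseteq> {A. A \<subseteq> T \<and> card A = card T - r \<and> shatters F (C \<union> A)}"
      using * by (auto simp: shattered_subsets_def)
    then have "card {A. A \<subseteq> T \<and> card A = p \<and> C \<union> A \<in> shattered_subsets n d F}
        \<le> card {A. A \<subseteq> T \<and> card A = card T - r \<and> shatters F (C \<union> A)}"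
      using fin by (intro card_mono) auto
    ultimately show "real (card {A. A \<subseteq> T \<and> card A = p \<and> C \<union> A \<in> shattered_subsets n d F})
        \<le> binary_basis_density r * real m ^ r / fact r"
      using * cp by simp
  qed simp
  moreover have "(p + r) choose p = m choose r"
    using binomial_symmetric[of p "p + r"] by (simp flip: cp(2))
  ultimately show ?thesis using cp max by simp
qed

section \<open>Limits of the two bounds\<close>

lemma power_over_falling_factorial_tendsto:
  "(\<lambda>m. real m ^ r / (fact r * real (m choose r))) \<longlonglongrightarrow> 1"
proof -
  have "(\<lambda>m. \<Prod>i=0..<r. 1 - real i * (1 / real m)) \<longlonglongrightarrow> (\<Prod>i=0..<r. 1 - real i * 0)"
    by (intro tendsto_prod tendsto_diff tendsto_mult tendsto_const lim_1_over_n)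
  then have "(\<lambda>m. inverse (\<Prod>i=0..<r. 1 - real i * (1 / real m))) \<longlonglongrightarrow> inverse 1"
    by (intro tendsto_inverse) simp_all
  moreover have "eventually (\<lambda>m. inverse (\<Prod>i=0..<r. 1 - real i * (1 / real m))
      = real m ^ r / (fact r * real (m choose r))) sequentially"
    using eventually_gt_at_top[of 0]
  proof eventually_elim
    case (elim m)
    have "fact r * real (m choose r) = (\<Prod>i=0..<r. real m - real i)"
      by (simp add: binomial_gbinomial gbinomial_mult_fact)
    also have "\<dots> = (\<Prod>i=0..<r. real m * (1 - real i * (1 / real m)))"
      using elim by (intro prod.cong) (auto simp: field_simps)
    also have "\<dots> = real m ^ r * (\<Prod>i=0..<r. 1 - real i * (1 / real m))"
      by (simp only: prod.distrib prod_constant card_atLeastLessThan diff_zero)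
    finally show ?case using elim by (simp add: field_simps)
  qed
  ultimately show ?thesis by (simp add: tendsto_cong)
qed

lemma partial_products_tendsto:
  "(\<lambda>d. \<Prod>i<d. 1 - 1 / 2 ^ Suc i :: real) \<longlonglongrightarrow> (\<Prod>i. 1 - 1 / 2 ^ Suc i)"
  by (rule has_prod_imp_tendsto'[OF has_prod_one_minus_half_powers])

text \<open>Dividing numerators and denominators by \<open>2 ^ s\<close> turns the density into the
  s-th partial product of c over \<open>(1 - 1 / 2 ^ s) ^ s\<close>; Bernoulli's inequality shows
  that this divisor tends to 1.\<close>

lemma binary_basis_density_tendsto:
  "binary_basis_density \<longlonglongrightarrow> (\<Prod>i. 1 - 1 / 2 ^ Suc i)"
proof -
  have "(\<lambda>s. (1 - 1 / 2 ^ s :: real) ^ s) \<longlonglongrightarrow> 1"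
  proof (rule tendsto_sandwich)
    have "1 - real s * (1 / 2) ^ s \<le> (1 - 1 / 2 ^ s) ^ s" for s
      using Bernoulli_inequality[of "- (1 / 2 ^ s)" s] by (simp add: power_divide)
    then show "\<forall>\<^sub>F s in sequentially. 1 - real s * (1 / 2) ^ s \<le> (1 - 1 / 2 ^ s) ^ s" by simp
    show "\<forall>\<^sub>F s in sequentially. (1 - 1 / 2 ^ s :: real) ^ s \<le> 1"
      by (intro always_eventually allI power_le_one) auto
    have "(\<lambda>s. 1 - real s * (1 / 2) ^ s) \<longlonglongrightarrow> 1 - 0"
      by (intro tendsto_diff tendsto_const powser_times_n_limit_0) simp
    then show "(\<lambda>s. 1 - real s * (1 / 2) ^ s) \<longlonglongrightarrow> 1" by simp
  qed simp
  then have "(\<lambda>s. (\<Prod>i<s. 1 - 1 / 2 ^ Suc i) / (1 - 1 / 2 ^ s :: real) ^ s)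
      \<longlonglongrightarrow> (\<Prod>i. 1 - 1 / 2 ^ Suc i) / 1"
    by (intro tendsto_divide partial_products_tendsto) simp_all
  moreover have "(\<Prod>i<s. 1 - 1 / 2 ^ Suc i) / (1 - 1 / 2 ^ s) ^ s = binary_basis_density s" for s
  proof -
    have "binary_basis_density s = (\<Prod>i<s. (1 - 1 / 2 ^ (s - i)) / (1 - 1 / 2 ^ s))"
      unfolding binary_basis_density_def
    proof (intro prod.cong refl)
      fix i assume i: "i \<in> {..<s}"
      then have s: "(2::real) ^ s = 2 ^ (s - i) * 2 ^ i" by (simp flip: power_add)
      have pos: "(2::real) ^ s > 1" using i by simp
      have "(2 ^ s - 2 ^ i :: real) = 2 ^ s * (1 - 1 / 2 ^ (s - i))"
        using s by (simp add: right_diff_distrib)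
      moreover have "(2 ^ s - 1 :: real) = 2 ^ s * (1 - 1 / 2 ^ s)" by (simp add: right_diff_distrib)
      ultimately show "(2 ^ s - 2 ^ i) / (2 ^ s - 1 :: real) = (1 - 1 / 2 ^ (s - i)) / (1 - 1 / 2 ^ s)"
        by (simp only: mult_divide_mult_cancel_left_if) simp
    qed
    also have "\<dots> = (\<Prod>i<s. 1 - 1 / 2 ^ (s - i)) / (1 - 1 / 2 ^ s) ^ s"
      by (simp only: prod_dividef prod_constant card_lessThan)
    finally show ?thesis by (simp only: prod_one_minus_half_powers_rev)
  qed
  ultimately show ?thesis by simp
qed

theorem theorem1p3:
  fixes n k d :: "nat \<Rightarrow> nat"
  assumes "\<And>j. j \<ge> 1 \<Longrightarrow> n j \<ge> 1 \<and> k j \<ge> 1 \<and> d j \<ge> 1"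
    and "\<And>j. j \<ge> 1 \<Longrightarrow> k j \<ge> 2 ^ d j"
    and "\<And>j. j \<ge> 1 \<Longrightarrow> n j \<ge> d j"
    and "filterlim d at_top sequentially"
    and "filterlim (\<lambda>j. n j - d j) at_top sequentially"
    and "(\<lambda>j. real (k j) / 2 ^ d j) \<longlonglongrightarrow> 1"
  shows "(\<lambda>j. real (max_shattered (n j) (k j) (d j)) / real (n j choose d j))
           \<longlonglongrightarrow> (\<Prod>i. 1 - 1 / 2 ^ Suc i)"
proof (rule order_tendstoI)
  fix a :: real assume "a < (\<Prod>i. 1 - 1 / 2 ^ Suc i)"
  moreover have "(\<lambda>j. \<Prod>i<d j. 1 - 1 / 2 ^ Suc i :: real) \<longlonglongrightarrow> (\<Prod>i. 1 - 1 / 2 ^ Suc i)"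
    by (rule filterlim_compose[OF partial_products_tendsto assms(4)])
  ultimately have "\<forall>\<^sub>F j in sequentially. a < (\<Prod>i<d j. 1 - 1 / 2 ^ Suc i)"
    by (rule order_tendstoD(1)[rotated])
  then show "\<forall>\<^sub>F j in sequentially. a < real (max_shattered (n j) (k j) (d j)) / real (n j choose d j)"
    using eventually_ge_at_top[of 1]
  proof eventually_elim
    case (elim j)
    have "real (n j choose d j) * (\<Prod>i<d j. 1 - 1 / 2 ^ Suc i) \<le> real (max_shattered (n j) (k j) (d j))"
      using elim assms(2,3) by (intro max_shattered_lower_bound) auto
    moreover have "0 < real (n j choose d j)" using elim assms(3) by simp
    ultimately have "(\<Prod>i<d j. 1 - 1 / 2 ^ Suc i) \<le> real (max_shattered (n j) (k j) (d j)) / real (n j choose d j)"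
      by (simp only: pos_le_divide_eq mult.commute)
    then show ?case using elim by simp
  qed
next
  fix a :: real assume a: "(\<Prod>i. 1 - 1 / 2 ^ Suc i) < a"
  \<comment> \<open>The order of choices matters: r brings the density below a, then m, depending on
    r, makes the finite-size correction harmless, and only then does j grow with r and m
    fixed.\<close>
  obtain r where r: "binary_basis_density r < a"
    using order_tendstoD(2)[OF binary_basis_density_tendsto a] by (auto simp: eventually_sequentially)
  have "(\<lambda>m. binary_basis_density r * (real m ^ r / (fact r * real (m choose r)))) \<longlonglongrightarrow> binary_basis_density r * 1"
    by (intro tendsto_mult tendsto_const power_over_falling_factorial_tendsto)
  then have "\<forall>\<^sub>F m in sequentially. binary_basis_density r * (real m ^ r / (fact r * real (m choose r))) < a"
    using r order_tendstoD(2) by fastforce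
  then obtain m where m: "r \<le> m" "binary_basis_density r * (real m ^ r / (fact r * real (m choose r))) < a"
    using eventually_happens'[OF sequentially_bot eventually_conj[OF eventually_ge_at_top[of r]]] by blast
  \<comment> \<open>The threshold is \<open>2 ^ d j + 2 ^ (d j + r - m)\<close> divided by
    \<open>2 ^ d j\<close>; it exceeds 1 by an amount independent of j.\<close>
  have "\<forall>\<^sub>F j in sequentially. real (k j) / 2 ^ d j < 1 + 1 / 2 ^ (m - r)"
    using order_tendstoD(2)[OF assms(6)] by simp
  moreover have "\<forall>\<^sub>F j in sequentially. m \<le> d j" "\<forall>\<^sub>F j in sequentially. r \<le> n j - d j"
    using assms(4,5) by (simp_all add: filterlim_at_top)
  ultimately show "\<forall>\<^sub>F j in sequentially. real (max_shattered (n j) (k j) (d j)) / real (n j choose d j) < a"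
    using eventually_ge_at_top[of 1]
  proof eventually_elim
    case (elim j)
    have nd: "d j \<le> n j" using elim assms(3) by simp
    have "real (k j) < 2 ^ d j + 2 ^ (d j + r - m)"
    proof -
      have "(2::real) ^ d j = 2 ^ (d j + r - m) * 2 ^ (m - r)"
        using elim m(1) by (simp flip: power_add)
      then have "(2::real) ^ d j / 2 ^ (m - r) = 2 ^ (d j + r - m)" by simp
      moreover have "real (k j) < 2 ^ d j * (1 + 1 / 2 ^ (m - r))"
        using elim(1) by (simp add: divide_less_eq mult.commute)
      ultimately show ?thesis by (simp add: distrib_left)
    qed
    then have "real (k j) < real (2 ^ d j + 2 ^ (d j + r - m))" by simp
    then have "k j < 2 ^ d j + 2 ^ (d j + r - m)" by (simp only: of_nat_less_iff)
    then have "real (max_shattered (n j) (k j) (d j)) * real (m choose r)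
        \<le> binary_basis_density r * real m ^ r / fact r * real (n j choose d j)"
      using elim m(1) nd by (intro max_shattered_upper_bound) auto
    moreover have "0 < real (n j choose d j)" "0 < real (m choose r)" using nd m(1) by simp_all
    ultimately have "real (max_shattered (n j) (k j) (d j)) / real (n j choose d j)
        \<le> binary_basis_density r * (real m ^ r / (fact r * real (m choose r)))"
      by (simp add: field_simps)
    then show ?case using m(2) by simp
  qed
qed

end
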